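(* Let $N,p\ge 1$ be integers, let $x_1,\dots,x_N\in\mathcal{X}$ and $f:\mathcal{X}\to\mathbb{R}^p$, and let $w^{(0)}=(w^{(0)}(x_1),\dots,w^{(0)}(x_N))$ be a vector with $w^{(0)}(x_i)\ge 0$ for all $i$, $\sum_{i=1}^N w^{(0)}(x_i)=1$, and $\sum_{i=1}^N w^{(0)}(x_i)f(x_i)f^{T}(x_i)$ nonsingular. For $n\ge 1$ define $$w^{(n)}(x_i)=\frac{w^{(n-1)}(x_i)\,f^{T}(x_i)D^{(n-1)}f(x_i)}{p},\quad i=1,\dots,N,\qquad D^{(n-1)}=\Big[\sum_{j=1}^N w^{(n-1)}(x_j)f(x_j)f^{T}(x_j)\Big]^{-1}.$$ Assume that $\log\left|\sum_{i=1}^{N}f(x_i)f^{T}(x_i)\right|$ is bounded (i.e. finite). Then $$\sum_{i=1}^{N}\left|w^{(n)}(x_i)-w^{(n-1)}(x_i)\right|\longrightarrow 0\quad\text{as } n\to+\infty.$$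
   Context: $|A|$ denotes the determinant of a square matrix $A$. The set $\mathcal{X}$ is the design space, $f$ is the (known) regression function of the linear model $Y(x)=f^T(x)\beta+\varepsilon$, and the points $x_1,\dots,x_N$ are fixed throughout the iteration. The recursion is the iterative weight update of the paper's algorithm for computing an approximate $D$-optimal design, i.e. for minimizing $-\log\left|\sum_{i=1}^N w_i f(x_i)f^T(x_i)\right|$ over $w_i\ge 0$, $\sum_i w_i=1$. *)

theory Defs
  imports "HOL-Analysis.Analysis"
begin

text \<open>The matrix \<open>v v\<^sup>T\<close>.\<close>

definition outer :: "real ^ 'p \<Rightarrow> real ^ 'p ^ 'p" where
  "outer v = (columnvector v :: real ^ 1 ^ 'p) ** (rowvector v :: real ^ 'p ^ 1)"

text \<open>Weights are indexed by the position \<open>i \<in> {1..N}\<close> rather than by the point \<open>x i\<close>, so the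
  points need not be distinct.\<close>

definition info_matrix ::
    "('a \<Rightarrow> real ^ 'p) \<Rightarrow> nat \<Rightarrow> (nat \<Rightarrow> 'a) \<Rightarrow> (nat \<Rightarrow> real) \<Rightarrow> real ^ 'p ^ 'p" where
  "info_matrix f N x w = (\<Sum>i=1..N. w i *\<^sub>R outer (f (x i)))"

primrec weight_iter ::
    "('a \<Rightarrow> real ^ 'p) \<Rightarrow> nat \<Rightarrow> (nat \<Rightarrow> 'a) \<Rightarrow> (nat \<Rightarrow> real) \<Rightarrow> nat \<Rightarrow> nat \<Rightarrow> real" where
  "weight_iter f N x w0 0 = w0"
| "weight_iter f N x w0 (Suc n) =
    (let w = weight_iter f N x w0 n; D = matrix_inv (info_matrix f N x w)
     in (\<lambda>i. w i * (f (x i) \<bullet> (D *v f (x i))) / real CARD('p)))"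

text \<open>The library function \<open>ln\<close> has \<open>ln 0 = 0\<close>, so finiteness of a logarithm is only meaningful for an
  extended-valued version. The value at negative arguments is irrelevant: it is only applied to the
  determinant of a positive semidefinite matrix.\<close>

definition extended_ln :: "real \<Rightarrow> ereal" where
  "extended_ln t = (if t > 0 then ereal (ln t) else -\<infinity>)"

end

theory Submission
  imports Defs
begin

text \<open>By the Cauchy--Binet formula, \<open>P(w) = |\<Sum>\<^sub>i w\<^sub>i f(x\<^sub>i) f(x\<^sub>i)\<^sup>T|\<close> is a homogeneous polynomial of
  degree \<open>p\<close> in \<open>w\<close> with nonnegative coefficients, and the weight update is the Baum--Eagon map
  \<open>w'\<^sub>i = w\<^sub>i \<partial>\<^sub>iP(w) / (p P(w))\<close> of \<open>P\<close>. Jensen's inequality, with the monomials of \<open>P(w)\<close> divided by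
  \<open>P(w)\<close> as probability weights, yields \<open>P(w') \<ge> P(w) exp (p KL(w' | w))\<close>, and the relative entropy
  dominates the squared Hellinger distance. As \<open>P\<close> increases along the iteration and is bounded on the
  simplex, its increments and hence the Hellinger distances of consecutive weights tend to 0.\<close>

section \<open>A Cauchy--Binet formula indexed by functions\<close>

text \<open>Multilinearity in the rows: \<open>\<phi>\<close> records which summand each row
  contributes. Maps that repeat an index stay in the sum; their determinant has equal rows and
  vanishes.\<close>

lemma det_rows_sum_scaled:
  fixes b :: "'p::finite \<Rightarrow> 'i \<Rightarrow> real" and v :: "'i \<Rightarrow> real ^ 'p"
  assumes "finite I"
  shows "det (\<chi> k. \<Sum>i\<in>I. b k i *s v i) =
    (\<Sum>\<phi>\<in>UNIV \<rightarrow>\<^sub>E I. (\<Prod>k\<in>UNIV. b k (\<phi> k)) * det (\<chi> k. v (\<phi> k)))"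
proof -
  let ?P = "{\<sigma>. \<sigma> permutes (UNIV::'p set)}"
  have "det (\<chi> k. \<Sum>i\<in>I. b k i *s v i) =
      (\<Sum>\<sigma>\<in>?P. of_int (sign \<sigma>) * (\<Prod>k\<in>UNIV. \<Sum>i\<in>I. b k i * v i $ \<sigma> k))"
    by (simp add: det_def sum_component)
  also have "\<dots> = (\<Sum>\<sigma>\<in>?P. \<Sum>\<phi>\<in>UNIV \<rightarrow>\<^sub>E I.
      of_int (sign \<sigma>) * (\<Prod>k\<in>UNIV. b k (\<phi> k) * v (\<phi> k) $ \<sigma> k))"
    using assms by (simp add: prod_sum_PiE sum_distrib_left)
  also have "\<dots> = (\<Sum>\<phi>\<in>UNIV \<rightarrow>\<^sub>E I. \<Sum>\<sigma>\<in>?P.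
      of_int (sign \<sigma>) * (\<Prod>k\<in>UNIV. b k (\<phi> k) * v (\<phi> k) $ \<sigma> k))"
    by (rule sum.swap)
  also have "\<dots> = (\<Sum>\<phi>\<in>UNIV \<rightarrow>\<^sub>E I. (\<Prod>k\<in>UNIV. b k (\<phi> k)) * det (\<chi> k. v (\<phi> k)))"
    by (simp add: det_def sum_distrib_left prod.distrib mult_ac)
  finally show ?thesis .
qed

lemma bij_betw_permute_PiE_UNIV:
  fixes \<sigma> :: "'p::finite \<Rightarrow> 'p"
  assumes "\<sigma> permutes UNIV"
  shows "bij_betw (\<lambda>\<phi>. \<phi> \<circ> \<sigma>) (UNIV \<rightarrow>\<^sub>E I) (UNIV \<rightarrow>\<^sub>E I)"
  by (rule bij_betwI[where g = "\<lambda>\<phi>. \<phi> \<circ> inv \<sigma>"])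
    (auto simp: PiE_UNIV_domain fun_eq_iff permutes_inverses[OF assms])

text \<open>Replacing \<open>\<phi>\<close> by \<open>\<phi> \<circ> \<sigma>\<close> keeps
  \<open>a \<phi>\<close>, multiplies the determinant by the sign of \<open>\<sigma>\<close> and
  permutes the factors of the diagonal product. Averaging over all \<open>\<sigma>\<close> assembles
  these products into the Leibniz expansion of a second determinant.\<close>

lemma sum_symmetric_diagonal_det:
  fixes a :: "('p::finite \<Rightarrow> 'i) \<Rightarrow> real" and v :: "'i \<Rightarrow> real ^ 'p" and I :: "'i set"
  assumes sym: "\<And>\<phi> \<sigma>. \<sigma> permutes UNIV \<Longrightarrow> a (\<phi> \<circ> \<sigma>) = a \<phi>"
  shows "(\<Sum>\<phi>\<in>UNIV \<rightarrow>\<^sub>E I. a \<phi> * (\<Prod>k\<in>UNIV. v (\<phi> k) $ k) * det (\<chi> k. v (\<phi> k))) =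
    (\<Sum>\<phi>\<in>UNIV \<rightarrow>\<^sub>E I. a \<phi> * (det (\<chi> k. v (\<phi> k)))\<^sup>2) / fact CARD('p)"
    (is "?L = ?R / _")
proof -
  let ?P = "{\<sigma>. \<sigma> permutes (UNIV::'p set)}"
  let ?d = "\<lambda>\<phi>. det (\<chi> k. v (\<phi> k))"
  have L: "?L = (\<Sum>\<phi>\<in>UNIV \<rightarrow>\<^sub>E I. a \<phi> * ?d \<phi> * (of_int (sign \<sigma>) * (\<Prod>k\<in>UNIV. v (\<phi> k) $ inv \<sigma> k)))"
    if \<sigma>: "\<sigma> permutes UNIV" for \<sigma>
  proof -
    have "?d (\<phi> \<circ> \<sigma>) = of_int (sign \<sigma>) * ?d \<phi>" for \<phi>
      using det_permute_rows[OF \<sigma>, of "\<chi> k. v (\<phi> k)"] by simp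
    moreover have "(\<Prod>k\<in>UNIV. v ((\<phi> \<circ> \<sigma>) k) $ k) = (\<Prod>k\<in>UNIV. v (\<phi> k) $ inv \<sigma> k)" for \<phi>
      using prod.reindex_bij_betw[OF permutes_imp_bij[OF \<sigma>], of "\<lambda>k. v (\<phi> k) $ inv \<sigma> k"]
      by (simp add: permutes_inverses[OF \<sigma>])
    ultimately show ?thesis
      by (subst sum.reindex_bij_betw[OF bij_betw_permute_PiE_UNIV[OF \<sigma>], symmetric])
        (simp add: sym[OF \<sigma>] mult_ac del: o_apply)
  qed
  have "fact CARD('p) * ?L = (\<Sum>\<sigma>\<in>?P. ?L)"
    by (simp add: card_permutations)
  also have "\<dots> = (\<Sum>\<sigma>\<in>?P. \<Sum>\<phi>\<in>UNIV \<rightarrow>\<^sub>E I.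
      a \<phi> * ?d \<phi> * (of_int (sign \<sigma>) * (\<Prod>k\<in>UNIV. v (\<phi> k) $ inv \<sigma> k)))"
    by (intro sum.cong refl L) simp
  also have "\<dots> = (\<Sum>\<phi>\<in>UNIV \<rightarrow>\<^sub>E I. a \<phi> * ?d \<phi> *
      (\<Sum>\<sigma>\<in>?P. of_int (sign \<sigma>) * (\<Prod>k\<in>UNIV. v (\<phi> k) $ inv \<sigma> k)))"
    by (subst sum.swap) (simp add: sum_distrib_left)
  also have "\<dots> = (\<Sum>\<phi>\<in>UNIV \<rightarrow>\<^sub>E I. a \<phi> * ?d \<phi> * ?d \<phi>)"
  proof (intro sum.cong refl arg_cong2[where f = "(*)"])
    fix \<phi> :: "'p \<Rightarrow> 'i"
    \<comment> \<open>Inversion permutes the permutations and preserves signs, so the inverses can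
      be removed to reach the Leibniz formula.\<close>
    have "(\<Sum>\<sigma>\<in>?P. of_int (sign \<sigma>) * (\<Prod>k\<in>UNIV. v (\<phi> k) $ inv \<sigma> k)) =
        (\<Sum>\<sigma>\<in>?P. of_int (sign (inv \<sigma>)) * (\<Prod>k\<in>UNIV. v (\<phi> k) $ inv (inv \<sigma>) k))"
      by (rule sum_permutations_inverse)
    also have "\<dots> = ?d \<phi>"
      by (auto simp: det_def permutes_inv_inv sign_inverse permutation_permutes
          intro!: sum.cong) (metis finite_class.finite_UNIV permutation_permutes sign_inverse)
    finally show "(\<Sum>\<sigma>\<in>?P. of_int (sign \<sigma>) * (\<Prod>k\<in>UNIV. v (\<phi> k) $ inv \<sigma> k)) = ?d \<phi>" .
  qed
  finally show ?thesis
    by (simp add: field_simps power2_eq_square)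
qed

lemma outer_component: "outer v $ j $ k = v $ j * v $ k"
  by (simp add: outer_def matrix_matrix_mult_def columnvector_def rowvector_def)

lemma weighted_outer_rows:
  "(\<Sum>i\<in>I. w i *\<^sub>R outer (v i)) = (\<chi> k. \<Sum>i\<in>I. (w i * v i $ k) *s v i)"
  by (simp add: vec_eq_iff sum_component outer_component mult_ac)

text \<open>Each row of the weighted sum is a combination of the \<open>v i\<close>, so row
  expansion followed by symmetrisation applies. The factorial compensates for listing every set of
  \<open>CARD('p)\<close> indices once per ordering.\<close>

lemma det_weighted_outer:
  fixes v :: "'i \<Rightarrow> real ^ 'p"
  assumes "finite I"
  shows "det (\<Sum>i\<in>I. w i *\<^sub>R outer (v i)) =
    (\<Sum>\<phi>\<in>UNIV \<rightarrow>\<^sub>E I. (det (\<chi> k. v (\<phi> k)))\<^sup>2 / fact CARD('p) * (\<Prod>k\<in>UNIV. w (\<phi> k)))"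
proof -
  have sym: "(\<Prod>k\<in>UNIV. w ((\<phi> \<circ> \<sigma>) k)) = (\<Prod>k\<in>UNIV. w (\<phi> k))"
    if "\<sigma> permutes (UNIV :: 'p set)" for \<phi> \<sigma>
    using prod.reindex_bij_betw[OF permutes_imp_bij[OF that], of "\<lambda>k. w (\<phi> k)"] by simp
  have "det (\<Sum>i\<in>I. w i *\<^sub>R outer (v i)) =
    (\<Sum>\<phi>\<in>UNIV \<rightarrow>\<^sub>E I. (\<Prod>k\<in>UNIV. w (\<phi> k)) * (\<Prod>k\<in>UNIV. v (\<phi> k) $ k) * det (\<chi> k. v (\<phi> k)))"
    unfolding weighted_outer_rows det_rows_sum_scaled[OF assms] prod.distrib ..
  also have "\<dots> =
    (\<Sum>\<phi>\<in>UNIV \<rightarrow>\<^sub>E I. (\<Prod>k\<in>UNIV. w (\<phi> k)) * (det (\<chi> k. v (\<phi> k)))\<^sup>2) / fact CARD('p)"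
    by (rule sum_symmetric_diagonal_det[OF sym])
  finally show ?thesis
    by (simp add: sum_divide_distrib mult_ac)
qed

lemma matrix_inv_right:
  fixes A :: "real ^ 'n ^ 'n"
  assumes "invertible A"
  shows "A ** matrix_inv A = mat 1"
  using assms unfolding invertible_def matrix_inv_def by (rule someI2_ex) simp

text \<open>The right-hand side is \<open>w\<^sub>j \<partial>/\<partial>w\<^sub>j\<close> of the polynomial in \<open>det_weighted_outer\<close>;
  Cramer's rule gives it without differentiating the determinant.\<close>

lemma weighted_variance_times_det:
  fixes v :: "'i \<Rightarrow> real ^ 'p"
  defines "M \<equiv> \<lambda>w I. (\<Sum>i\<in>I. w i *\<^sub>R outer (v i))"
  assumes "finite I" "j \<in> I" and inv: "invertible (M w I)"
  shows "w j * (v j \<bullet> (matrix_inv (M w I) *v v j)) * det (M w I) =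
    (\<Sum>\<phi>\<in>UNIV \<rightarrow>\<^sub>E I. (det (\<chi> k. v (\<phi> k)))\<^sup>2 / fact CARD('p) * (\<Prod>k\<in>UNIV. w (\<phi> k)) * card {k. \<phi> k = j})"
proof -
  define y where "y = matrix_inv (M w I) *v v j"
  have My: "M w I *v y = v j"
    by (simp add: y_def matrix_vector_mul_assoc matrix_inv_right[OF inv])
  \<comment> \<open>By symmetry of the matrix, the columns combined by \<open>y\<close> may be read
    as rows, the form used by \<open>cramer_lemma_transpose\<close>.\<close>
  have "(\<Sum>i\<in>UNIV. y $ i *s row i (M w I)) = M w I *v y"
    by (simp add: M_def weighted_outer_rows vec_eq_iff sum_component row_def
        matrix_vector_mult_def mult_ac)
  then have comb: "(\<Sum>i\<in>UNIV. y $ i *s row i (M w I)) = v j"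
    by (simp add: My)
  have cramer: "det (\<chi> l. if l = k then v j else row l (M w I)) = y $ k * det (M w I)" for k
    using cramer_lemma_transpose[of k y "M w I"] unfolding comb .
  have sub: "w j * v j $ k * (y $ k * det (M w I)) = (\<Sum>\<phi>\<in>UNIV \<rightarrow>\<^sub>E I. if \<phi> k = j then
      (\<Prod>l\<in>UNIV. w (\<phi> l)) * (\<Prod>l\<in>UNIV. v (\<phi> l) $ l) * det (\<chi> l. v (\<phi> l)) else 0)" for k
  proof -
    \<comment> \<open>Row \<open>k\<close> keeps only its \<open>j\<close>-th summand, a multiple of
      \<open>v j\<close>, and the other rows are those of \<open>M w I\<close>. Expanding Cramer's
      determinant thus leaves exactly the maps with \<open>\<phi> k = j\<close>.\<close>
    define b where "b l i = (if l = k \<and> i \<noteq> j then 0 else w i * v i $ l)" for l i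
    have "(\<Sum>i\<in>I. b k i *s v i) = (\<Sum>i\<in>I. if i = j then (w j * v j $ k) *s v j else 0)"
      by (intro sum.cong) (auto simp: b_def)
    then have "(\<chi> l. \<Sum>i\<in>I. b l i *s v i) =
        (\<chi> l. if l = k then (w j * v j $ k) *s v j else row l (M w I))"
      using assms(2,3) by (auto simp: vec_eq_iff b_def M_def weighted_outer_rows row_def)
    then have "w j * v j $ k * (y $ k * det (M w I)) = det (\<chi> l. \<Sum>i\<in>I. b l i *s v i)"
      by (simp add: det_row_mul cramer)
    also have "\<dots> = (\<Sum>\<phi>\<in>UNIV \<rightarrow>\<^sub>E I. (\<Prod>l\<in>UNIV. b l (\<phi> l)) * det (\<chi> l. v (\<phi> l)))"
      by (rule det_rows_sum_scaled) fact
    also have "\<dots> = (\<Sum>\<phi>\<in>UNIV \<rightarrow>\<^sub>E I. if \<phi> k = j then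
      (\<Prod>l\<in>UNIV. w (\<phi> l)) * (\<Prod>l\<in>UNIV. v (\<phi> l) $ l) * det (\<chi> l. v (\<phi> l)) else 0)"
    proof (intro sum.cong refl)
      fix \<phi> :: "'p \<Rightarrow> 'i"
      have "(\<Prod>l\<in>UNIV. b l (\<phi> l)) = (if \<phi> k = j
          then (\<Prod>l\<in>UNIV. w (\<phi> l)) * (\<Prod>l\<in>UNIV. v (\<phi> l) $ l) else 0)"
        by (auto simp: b_def prod.distrib[symmetric] intro!: prod.cong)
      then show "(\<Prod>l\<in>UNIV. b l (\<phi> l)) * det (\<chi> l. v (\<phi> l)) = (if \<phi> k = j then
          (\<Prod>l\<in>UNIV. w (\<phi> l)) * (\<Prod>l\<in>UNIV. v (\<phi> l) $ l) * det (\<chi> l. v (\<phi> l)) else 0)"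
        by simp
    qed
    finally show ?thesis .
  qed
  \<comment> \<open>Summing over \<open>k\<close> counts the positions where \<open>\<phi>\<close>
    takes the value \<open>j\<close>. Permuting positions does not change this count, so
    symmetrisation applies again.\<close>
  let ?a = "\<lambda>\<phi>::'p \<Rightarrow> 'i. (\<Prod>l\<in>UNIV. w (\<phi> l)) * real (card {k. \<phi> k = j})"
  have sym: "?a (\<phi> \<circ> \<sigma>) = ?a \<phi>" if \<sigma>: "\<sigma> permutes (UNIV :: 'p set)" for \<phi> \<sigma>
  proof -
    have "bij_betw \<sigma> {k. (\<phi> \<circ> \<sigma>) k = j} {k. \<phi> k = j}"
      by (rule bij_betwI[where g = "inv \<sigma>"]) (auto simp: permutes_inverses[OF \<sigma>])
    then have "card {k. (\<phi> \<circ> \<sigma>) k = j} = card {k. \<phi> k = j}"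
      by (rule bij_betw_same_card)
    then show ?thesis
      using prod.reindex_bij_betw[OF permutes_imp_bij[OF \<sigma>], of "\<lambda>k. w (\<phi> k)"] by simp
  qed
  have "w j * (v j \<bullet> y) * det (M w I) = (\<Sum>k\<in>UNIV. w j * v j $ k * (y $ k * det (M w I)))"
    by (simp add: inner_vec_def sum_distrib_left sum_distrib_right mult_ac)
  also have "\<dots> = (\<Sum>\<phi>\<in>UNIV \<rightarrow>\<^sub>E I. \<Sum>k\<in>UNIV. if \<phi> k = j then
      (\<Prod>l\<in>UNIV. w (\<phi> l)) * (\<Prod>l\<in>UNIV. v (\<phi> l) $ l) * det (\<chi> l. v (\<phi> l)) else 0)"
    unfolding sub by (rule sum.swap)
  also have "\<dots> = (\<Sum>\<phi>\<in>UNIV \<rightarrow>\<^sub>E I. ?a \<phi> * (\<Prod>l\<in>UNIV. v (\<phi> l) $ l) * det (\<chi> l. v (\<phi> l)))"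
    by (simp add: sum.If_cases mult_ac)
  also have "\<dots> = (\<Sum>\<phi>\<in>UNIV \<rightarrow>\<^sub>E I. ?a \<phi> * (det (\<chi> k. v (\<phi> k)))\<^sup>2) / fact CARD('p)"
    by (rule sum_symmetric_diagonal_det[OF sym])
  finally show ?thesis
    by (simp add: y_def sum_divide_distrib mult_ac)
qed

section \<open>The Baum--Eagon inequality\<close>

text \<open>The tangent of \<open>exp\<close> at the weighted mean \<open>m\<close> lies below
  \<open>exp\<close>, and its linear part averages to zero. This is Jensen's inequality for weights
  of arbitrary positive total.\<close>

lemma exp_weighted_mean_le:
  fixes q s :: "'a \<Rightarrow> real"
  assumes q: "\<And>a. a \<in> A \<Longrightarrow> q a \<ge> 0" and Q: "sum q A > 0"
  shows "sum q A * exp ((\<Sum>a\<in>A. q a * s a) / sum q A) \<le> (\<Sum>a\<in>A. q a * exp (s a))"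
proof -
  define m where "m = (\<Sum>a\<in>A. q a * s a) / sum q A"
  have "(\<Sum>a\<in>A. q a * (1 + (s a - m))) = sum q A + (\<Sum>a\<in>A. q a * s a) - sum q A * m"
    by (simp add: algebra_simps sum.distrib sum_subtractf sum_distrib_left)
  then have "sum q A * exp m = exp m * (\<Sum>a\<in>A. q a * (1 + (s a - m)))"
    using Q by (simp add: m_def)
  also have "\<dots> \<le> exp m * (\<Sum>a\<in>A. q a * exp (s a - m))"
    by (intro mult_left_mono sum_mono q exp_ge_add_one_self) auto
  also have "\<dots> = (\<Sum>a\<in>A. q a * exp (s a))"
    by (simp add: sum_distrib_left exp_diff)
  finally show ?thesis
    by (simp add: m_def)
qed

lemma sum_card_fibre:
  fixes g :: "'i \<Rightarrow> real" and \<phi> :: "'p::finite \<Rightarrow> 'i"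
  assumes "finite I" "\<phi> \<in> UNIV \<rightarrow>\<^sub>E I"
  shows "(\<Sum>j\<in>I. real (card {k. \<phi> k = j}) * g j) = (\<Sum>k\<in>UNIV. g (\<phi> k))"
proof -
  have "(\<Sum>j\<in>I. real (card {k. \<phi> k = j}) * g j) = (\<Sum>j\<in>I. \<Sum>k\<in>{k \<in> UNIV. \<phi> k = j}. g (\<phi> k))"
    by simp
  also have "\<dots> = (\<Sum>k\<in>UNIV. g (\<phi> k))"
    using assms by (intro sum.group) auto
  finally show ?thesis .
qed

text \<open>The sum in the exponent is the relative entropy of \<open>w'\<close> with respect to \<open>w\<close>; where
  \<open>w j = 0\<close> also \<open>w' j = 0\<close>, so the junk value of the logarithm does not matter.\<close>

lemma Baum_Eagon:
  fixes c :: "('p::finite \<Rightarrow> 'i) \<Rightarrow> real" and w w' :: "'i \<Rightarrow> real" and I :: "'i set"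
  defines "P \<equiv> \<lambda>u. \<Sum>\<phi>\<in>UNIV \<rightarrow>\<^sub>E I. c \<phi> * (\<Prod>k\<in>UNIV. u (\<phi> k))"
  assumes I: "finite I" and c: "\<And>\<phi>. \<phi> \<in> UNIV \<rightarrow>\<^sub>E I \<Longrightarrow> c \<phi> \<ge> 0"
    and w: "\<And>j. j \<in> I \<Longrightarrow> w j \<ge> 0" and pos: "P w > 0"
    and w': "\<And>j. j \<in> I \<Longrightarrow> (\<Sum>\<phi>\<in>UNIV \<rightarrow>\<^sub>E I. c \<phi> * (\<Prod>k\<in>UNIV. w (\<phi> k)) * card {k. \<phi> k = j})
      = real CARD('p) * w' j * P w"
  shows "(\<Sum>j\<in>I. w' j) = 1" and "\<And>j. j \<in> I \<Longrightarrow> w' j \<ge> 0"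
    and "P w * exp (real CARD('p) * (\<Sum>j\<in>I. w' j * ln (w' j / w j))) \<le> P w'"
proof -
  let ?F = "(UNIV :: 'p set) \<rightarrow>\<^sub>E I" and ?p = "real CARD('p)"
  define q where "q \<phi> = c \<phi> * (\<Prod>k\<in>UNIV. w (\<phi> k))" for \<phi>
  define r where "r j = ln (w' j / w j)" for j
  have finF: "finite ?F"
    using I by (intro finite_PiE) auto
  have inI: "\<phi> k \<in> I" if "\<phi> \<in> ?F" for \<phi> k
    using that by auto
  have q0: "q \<phi> \<ge> 0" if "\<phi> \<in> ?F" for \<phi>
    using that by (auto simp: q_def intro!: mult_nonneg_nonneg prod_nonneg c w)
  have Pq: "P w = sum q ?F"
    by (simp add: P_def q_def)
  \<comment> \<open>The assumption on \<open>w'\<close> turns means over monomials, weighted by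
    \<open>q\<close>, into means over indices, weighted by \<open>w'\<close>. The constant
    \<open>1\<close> gives the total of \<open>w'\<close>, and \<open>r\<close> gives the exponent
    in Jensen's inequality.\<close>
  have mean: "(\<Sum>\<phi>\<in>?F. q \<phi> * (\<Sum>k\<in>UNIV. g (\<phi> k))) = ?p * (\<Sum>j\<in>I. w' j * g j) * P w" for g
  proof -
    have "(\<Sum>\<phi>\<in>?F. q \<phi> * (\<Sum>k\<in>UNIV. g (\<phi> k))) =
        (\<Sum>\<phi>\<in>?F. \<Sum>j\<in>I. q \<phi> * card {k. \<phi> k = j} * g j)"
      by (intro sum.cong refl) (simp add: sum_card_fibre[OF I, symmetric] sum_distrib_left mult_ac)
    also have "\<dots> = (\<Sum>j\<in>I. (\<Sum>\<phi>\<in>?F. q \<phi> * card {k. \<phi> k = j}) * g j)"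
      by (subst sum.swap) (simp add: sum_distrib_right)
    also have "\<dots> = (\<Sum>j\<in>I. ?p * w' j * P w * g j)"
      by (intro sum.cong refl) (simp add: q_def w')
    finally show ?thesis
      by (simp add: sum_distrib_left sum_distrib_right mult_ac)
  qed
  show "(\<Sum>j\<in>I. w' j) = 1"
    using mean[of "\<lambda>_. 1"] pos by (simp add: sum_distrib_right[symmetric] Pq[symmetric])
  show w'0: "w' j \<ge> 0" if "j \<in> I" for j
  proof -
    have "?p * w' j * P w \<ge> 0"
      unfolding w'[OF that, symmetric] using q0 by (intro sum_nonneg) (simp add: q_def)
    then show ?thesis
      using pos by (simp add: zero_le_mult_iff)
  qed
  have term_le: "q \<phi> * exp (\<Sum>k\<in>UNIV. r (\<phi> k)) \<le> c \<phi> * (\<Prod>k\<in>UNIV. w' (\<phi> k))" if \<phi>: "\<phi> \<in> ?F" for \<phi>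
  proof (cases "q \<phi> = 0")
    case True
    with \<phi> show ?thesis
      by (auto intro!: mult_nonneg_nonneg prod_nonneg c w'0)
  next
    case False
    with q0[OF \<phi>] have "q \<phi> > 0" by simp
    have wpos: "w (\<phi> k) > 0" for k
      using False w[OF inI[OF \<phi>], of k] by (auto simp: q_def prod_zero_iff less_le)
    \<comment> \<open>The monomial of \<open>\<phi>\<close> is itself one of the nonnegative terms
      that make up \<open>w' (\<phi> k)\<close>. Hence all logarithms in the exponent are genuine
      and \<open>exp\<close> undoes them.\<close>
    have w'pos: "w' (\<phi> k) > 0" for k
    proof -
      have "0 < q \<phi> * card {l. \<phi> l = \<phi> k}"
        using \<open>q \<phi> > 0\<close> by (intro mult_pos_pos) (auto simp: card_gt_0_iff)
      also have "\<dots> \<le> (\<Sum>\<phi>'\<in>?F. q \<phi>' * card {l. \<phi>' l = \<phi> k})"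
        using q0 \<phi> finF by (intro member_le_sum) auto
      also have "\<dots> = ?p * w' (\<phi> k) * P w"
        unfolding q_def by (rule w'[OF inI[OF \<phi>]])
      finally show ?thesis
        using pos by (simp add: zero_less_mult_iff)
    qed
    have "q \<phi> * exp (\<Sum>k\<in>UNIV. r (\<phi> k)) = q \<phi> * (\<Prod>k\<in>UNIV. w' (\<phi> k) / w (\<phi> k))"
      using wpos w'pos by (simp add: exp_sum r_def)
    also have "\<dots> = c \<phi> * (\<Prod>k\<in>UNIV. w' (\<phi> k))"
      using wpos by (simp add: q_def prod_dividef less_imp_neq[symmetric])
    finally show ?thesis by simp
  qed
  have "P w * exp (?p * (\<Sum>j\<in>I. w' j * r j)) =
      sum q ?F * exp ((\<Sum>\<phi>\<in>?F. q \<phi> * (\<Sum>k\<in>UNIV. r (\<phi> k))) / sum q ?F)"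
    using pos by (simp add: mean Pq)
  also have "\<dots> \<le> (\<Sum>\<phi>\<in>?F. q \<phi> * exp (\<Sum>k\<in>UNIV. r (\<phi> k)))"
    using pos by (intro exp_weighted_mean_le q0) (auto simp: Pq)
  also have "\<dots> \<le> P w'"
    unfolding P_def by (intro sum_mono term_le)
  finally show "P w * exp (?p * (\<Sum>j\<in>I. w' j * ln (w' j / w j))) \<le> P w'"
    by (simp add: r_def)
qed

text \<open>The bound \<open>ln t \<le> t - 1\<close> at \<open>t = sqrt (b i) / sqrt (a i)\<close>
  gives a termwise estimate with \<open>2 * a i\<close> in place of \<open>a i + b i\<close>; the
  two agree after summation since both totals are one. Absolute continuity rules out terms where
  division by zero would hide an infinite entropy.\<close>

lemma relative_entropy_ge_Hellinger:
  fixes a b :: "'i \<Rightarrow> real"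
  assumes nonneg: "\<And>i. i \<in> I \<Longrightarrow> a i \<ge> 0" "\<And>i. i \<in> I \<Longrightarrow> b i \<ge> 0"
    and abs_cont: "\<And>i. i \<in> I \<Longrightarrow> b i = 0 \<Longrightarrow> a i = 0"
    and total: "sum a I = 1" "sum b I = 1"
  shows "(\<Sum>i\<in>I. (sqrt (a i) - sqrt (b i))\<^sup>2) \<le> (\<Sum>i\<in>I. a i * ln (a i / b i))"
proof -
  have "2 * a i - 2 * (sqrt (a i) * sqrt (b i)) \<le> a i * ln (a i / b i)" if i: "i \<in> I" for i
  proof (cases "a i = 0")
    case False
    with nonneg[OF i] abs_cont[OF i] have pos: "a i > 0" "b i > 0"
      by (auto simp: less_le)
    have "ln (a i / b i) = - 2 * ln (sqrt (b i) / sqrt (a i))"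
      using pos by (simp add: ln_div ln_sqrt)
    moreover have "ln (sqrt (b i) / sqrt (a i)) \<le> sqrt (b i) / sqrt (a i) - 1"
      using pos by (intro ln_le_minus_one) simp
    ultimately have "2 - 2 * (sqrt (b i) / sqrt (a i)) \<le> ln (a i / b i)"
      by simp
    then have "a i * (2 - 2 * (sqrt (b i) / sqrt (a i))) \<le> a i * ln (a i / b i)"
      using pos by (intro mult_left_mono) auto
    moreover have "a i * (sqrt (b i) / sqrt (a i)) = sqrt (a i) * sqrt (b i)"
      using pos by (metis less_eq_real_def mult.commute real_div_sqrt times_divide_eq_left
          times_divide_eq_right)
    ultimately show ?thesis
      unfolding right_diff_distrib by (simp add: mult.left_commute[of "a i"] mult.commute[of "a i" 2])
  qed simp
  then have "(\<Sum>i\<in>I. 2 * a i - 2 * (sqrt (a i) * sqrt (b i))) \<le> (\<Sum>i\<in>I. a i * ln (a i / b i))"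
    by (rule sum_mono)
  moreover have "(\<Sum>i\<in>I. (sqrt (a i) - sqrt (b i))\<^sup>2) =
      (\<Sum>i\<in>I. a i + b i - 2 * (sqrt (a i) * sqrt (b i)))"
    using nonneg by (intro sum.cong) (auto simp: power2_diff)
  ultimately show ?thesis
    using total by (simp add: sum_subtractf sum.distrib sum_distrib_left[symmetric])
qed

text \<open>Factor \<open>a - b\<close> through the square roots, whose sum is at most two. The root
  of a square on the right is kept for comparison with the root of a sum of such squares.\<close>

lemma abs_diff_le_sqrt_diff:
  fixes a b :: real
  assumes "0 \<le> a" "a \<le> 1" "0 \<le> b" "b \<le> 1"
  shows "\<bar>a - b\<bar> \<le> 2 * sqrt ((sqrt a - sqrt b)\<^sup>2)"
proof -
  have "a - b = (sqrt a - sqrt b) * (sqrt a + sqrt b)"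
    using assms by (simp add: algebra_simps)
  then have "\<bar>a - b\<bar> = \<bar>sqrt a - sqrt b\<bar> * (sqrt a + sqrt b)"
    using assms by (simp add: abs_mult)
  also have "\<dots> \<le> \<bar>sqrt a - sqrt b\<bar> * 2"
    using assms real_sqrt_le_1_iff[of a] real_sqrt_le_1_iff[of b] by (intro mult_left_mono) linarith+
  finally show ?thesis by simp
qed

section \<open>Convergence of the weight updates\<close>

theorem theorem2:
  fixes X :: "'a set" and f :: "'a \<Rightarrow> real ^ 'p"
    and N :: nat and x :: "nat \<Rightarrow> 'a" and w0 :: "nat \<Rightarrow> real"
  assumes "N \<ge> 1"
    and "\<And>i. i \<in> {1..N} \<Longrightarrow> x i \<in> X"
    and "\<And>i. i \<in> {1..N} \<Longrightarrow> w0 i \<ge> 0"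
    and "(\<Sum>i=1..N. w0 i) = 1"
    and "invertible (info_matrix f N x w0)"
    and "\<bar>extended_ln (det (\<Sum>i=1..N. outer (f (x i))))\<bar> \<noteq> \<infinity>"
  shows "(\<lambda>n. \<Sum>i=1..N. \<bar>weight_iter f N x w0 (Suc n) i - weight_iter f N x w0 n i\<bar>) \<longlonglongrightarrow> 0"
proof -
  define I where "I = {1..N}"
  let ?F = "(UNIV :: 'p set) \<rightarrow>\<^sub>E I" and ?p = "real CARD('p)"
  define c where "c \<phi> = (det (\<chi> k. f (x (\<phi> k))))\<^sup>2 / fact CARD('p)" for \<phi> :: "'p \<Rightarrow> nat"
  define P where "P u = (\<Sum>\<phi>\<in>?F. c \<phi> * (\<Prod>k\<in>UNIV. u (\<phi> k)))" for u
  define w where "w n = weight_iter f N x w0 n" for n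
  define H where "H n = (\<Sum>i\<in>I. (sqrt (w (Suc n) i) - sqrt (w n i))\<^sup>2)" for n
  have I: "finite I"
    by (simp add: I_def)
  have c: "c \<phi> \<ge> 0" for \<phi>
    by (simp add: c_def)
  have det_info: "det (info_matrix f N x u) = P u" for u
    unfolding info_matrix_def P_def c_def I_def by (rule det_weighted_outer) simp
  \<comment> \<open>Baum--Eagon, the Hellinger bound and \<open>exp t \<ge> 1 + t\<close> combine
    into a relative gain of at least \<open>?p * H n\<close> per update.\<close>
  have step: "(\<forall>j\<in>I. w (Suc n) j \<ge> 0) \<and> sum (w (Suc n)) I = 1 \<and> P (w n) * (1 + ?p * H n) \<le> P (w (Suc n))"
    if wn: "\<forall>j\<in>I. w n j \<ge> 0" "sum (w n) I = 1" "P (w n) > 0" for n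
  proof -
    have inv: "invertible (\<Sum>i\<in>I. w n i *\<^sub>R outer (f (x i)))"
      using wn(3) by (simp add: invertible_det_nz det_info[symmetric] info_matrix_def I_def)
    have upd: "(\<Sum>\<phi>\<in>?F. c \<phi> * (\<Prod>k\<in>UNIV. w n (\<phi> k)) * card {k. \<phi> k = j}) =
        ?p * w (Suc n) j * P (w n)" if "j \<in> I" for j
      using weighted_variance_times_det[OF I that inv] det_info[of "w n"]
      by (simp add: c_def w_def Let_def info_matrix_def I_def)
    note BE = Baum_Eagon[where c = c and I = I and w = "w n" and w' = "w (Suc n)",
        folded P_def, OF I c _ wn(3) upd]
    have nonneg: "\<forall>j\<in>I. w (Suc n) j \<ge> 0" and total: "sum (w (Suc n)) I = 1"
      using BE(1,2) wn(1) by auto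
    \<comment> \<open>Absolute continuity holds because the update multiplies the old weight: a zero
      weight remains zero.\<close>
    have "H n \<le> (\<Sum>j\<in>I. w (Suc n) j * ln (w (Suc n) j / w n j))"
      unfolding H_def using wn nonneg total
      by (intro relative_entropy_ge_Hellinger) (auto simp: w_def Let_def)
    then have "1 + ?p * H n \<le> 1 + ?p * (\<Sum>j\<in>I. w (Suc n) j * ln (w (Suc n) j / w n j))"
      by simp
    also have "\<dots> \<le> exp (?p * (\<Sum>j\<in>I. w (Suc n) j * ln (w (Suc n) j / w n j)))"
      by (rule exp_ge_add_one_self)
    finally have "P (w n) * (1 + ?p * H n) \<le>
        P (w n) * exp (?p * (\<Sum>j\<in>I. w (Suc n) j * ln (w (Suc n) j / w n j)))"
      using wn(3) by (intro mult_left_mono) auto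
    also have "\<dots> \<le> P (w (Suc n))"
      using BE(3) wn(1) by simp
    finally show ?thesis
      using nonneg total by blast
  qed
  have H0: "H n \<ge> 0" for n
    by (simp add: H_def sum_nonneg)
  have "P w0 \<ge> 0"
    unfolding P_def using assms(3)
    by (intro sum_nonneg mult_nonneg_nonneg c prod_nonneg ballI) (simp add: I_def PiE_UNIV_domain Pi_iff)
  moreover have "P w0 \<noteq> 0"
    using assms(5) by (simp add: invertible_det_nz det_info)
  ultimately have P0: "P w0 > 0" by simp
  \<comment> \<open>The lower bound \<open>P w0\<close> keeps every information matrix nonsingular,
    so each update uses a true inverse, and it makes the gain estimate below uniform in
    \<open>n\<close>.\<close>
  have invar: "(\<forall>j\<in>I. w n j \<ge> 0) \<and> sum (w n) I = 1 \<and> P (w n) \<ge> P w0" for n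
  proof (induction n)
    case 0
    then show ?case
      using assms(3,4) by (simp add: w_def I_def)
  next
    case (Suc n)
    then have "P (w n) > 0"
      using P0 by simp
    then have "P (w n) \<le> P (w n) * (1 + ?p * H n)"
      using H0[of n] by simp
    moreover have "(\<forall>j\<in>I. w (Suc n) j \<ge> 0) \<and> sum (w (Suc n)) I = 1 \<and>
        P (w n) * (1 + ?p * H n) \<le> P (w (Suc n))"
      using Suc \<open>P (w n) > 0\<close> by (intro step) auto
    ultimately show ?case
      using Suc by auto
  qed
  have le1: "w n j \<le> 1" if "j \<in> I" for n j
    using invar[of n] member_le_sum[of j I "w n"] that I by auto
  have Pgap: "P w0 * (?p * H n) \<le> P (w (Suc n)) - P (w n)" for n
  proof -
    have "P w0 * (?p * H n) \<le> P (w n) * (?p * H n)"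
      using invar[of n] H0[of n] by (intro mult_right_mono) auto
    moreover have "P (w n) * (1 + ?p * H n) \<le> P (w (Suc n))"
      using step[of n] invar[of n] P0 by auto
    ultimately show ?thesis
      by (simp add: algebra_simps)
  qed
  have "incseq (\<lambda>n. P (w n))"
  proof (rule incseq_SucI)
    fix n
    have "0 \<le> P w0 * (?p * H n)"
      using P0 H0 by simp
    with Pgap[of n] show "P (w n) \<le> P (w (Suc n))"
      by linarith
  qed
  \<comment> \<open>Weights on the simplex are at most one, hence so is every monomial. The sum of
    the coefficients is the value of \<open>P\<close> at all weights one, the determinant of the
    unweighted sum.\<close>
  moreover have "P (w n) \<le> sum c ?F" for n
    unfolding P_def
  proof (rule sum_mono)
    fix \<phi> assume "\<phi> \<in> ?F"
    then have "(\<Prod>k\<in>UNIV. w n (\<phi> k)) \<le> 1"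
      using invar[of n] le1[of _ n] by (intro prod_le_1) auto
    then show "c \<phi> * (\<Prod>k\<in>UNIV. w n (\<phi> k)) \<le> c \<phi>"
      using c[of \<phi>] by (simp add: mult_left_le)
  qed
  ultimately obtain L where "(\<lambda>n. P (w n)) \<longlonglongrightarrow> L"
    using incseq_convergent by blast
  then have "(\<lambda>n. P (w (Suc n)) - P (w n)) \<longlonglongrightarrow> L - L"
    by (intro tendsto_diff LIMSEQ_Suc)
  then have gap0: "(\<lambda>n. (P (w (Suc n)) - P (w n)) / (P w0 * ?p)) \<longlonglongrightarrow> 0"
    by (simp add: tendsto_divide_zero)
  have "H n \<le> (P (w (Suc n)) - P (w n)) / (P w0 * ?p)" for n
    using Pgap[of n] P0 by (simp add: pos_le_divide_eq mult_ac)
  then have "H \<longlonglongrightarrow> 0"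
    using H0 by (intro tendsto_sandwich[OF _ _ tendsto_const gap0] always_eventually allI)
  then have "(\<lambda>n. \<Sum>i\<in>I. 2 * sqrt (H n)) \<longlonglongrightarrow> (\<Sum>i\<in>I. 2 * sqrt 0)"
    by (intro tendsto_intros)
  then have bound0: "(\<lambda>n. \<Sum>i\<in>I. 2 * sqrt (H n)) \<longlonglongrightarrow> 0"
    by simp
  have "(\<Sum>i\<in>I. \<bar>w (Suc n) i - w n i\<bar>) \<le> (\<Sum>i\<in>I. 2 * sqrt (H n))" for n
  proof (rule sum_mono)
    fix i assume i: "i \<in> I"
    have "\<bar>w (Suc n) i - w n i\<bar> \<le> 2 * sqrt ((sqrt (w (Suc n) i) - sqrt (w n i))\<^sup>2)"
      using invar le1 i by (intro abs_diff_le_sqrt_diff) auto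
    also have "\<dots> \<le> 2 * sqrt (H n)"
      \<comment> \<open>A single squared root difference is one of the nonnegative terms of
        \<open>H n\<close>.\<close>
      unfolding H_def using i I
      by (intro mult_left_mono real_sqrt_le_mono member_le_sum) auto
    finally show "\<bar>w (Suc n) i - w n i\<bar> \<le> 2 * sqrt (H n)" .
  qed
  then have "(\<lambda>n. \<Sum>i\<in>I. \<bar>w (Suc n) i - w n i\<bar>) \<longlonglongrightarrow> 0"
    by (intro tendsto_sandwich[OF _ _ tendsto_const bound0] always_eventually allI)
      (simp_all add: sum_nonneg)
  then show ?thesis
    by (simp add: w_def I_def)
qed

end
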